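(* Let $A=M^TM$ with $M\in\mathbb{R}^{m\times d}$, let $\lambda_1\ge\lambda_2\ge\dots\ge\lambda_d$ be the eigenvalues of $A$, and assume $\delta=\lambda_1-\lambda_2>0$. Let $v_1$ be a unit eigenvector of $A$ for $\lambda_1$, put $x^*=v_1$, and let $f:\mathbb{S}^{d-1}\to\mathbb{R}$, $f(x)=-x^TAx$, with minimum value $f^*=f(x^* )=-\lambda_1$. For $a>0$ let $B_a=\{x\in\mathbb{S}^{d-1} : \langle x,v_1\rangle\ge a\}$. Then for every $a>0$ and every $x\in B_a$, $$2a\,(f(x)-f^* )\le\langle \mathrm{grad} f(x),-\log_x(x^* )\rangle .$$
   Context: $\mathbb{S}^{d-1}$ is the unit sphere of $\mathbb{R}^d$ with the Riemannian metric inherited from $\mathbb{R}^d$. The tangent space at $x$ is $T_x\mathbb{S}^{d-1}=\{u\in\mathbb{R}^d:\langle u,x\rangle=0\}$ and $P_x=I-xx^T$ is the orthogonal projector onto it. The Riemannian gradient of $f$ at $x$ is $\mathrm{grad}f(x)=P_x\nabla f(x)$, where $\nabla f(x)$ is the Euclidean gradient, here $-2Ax$. The intrinsic distance is $\mathrm{dist}(p,q)=\arccos\langle p,q\rangle$. The logarithm is $\log_p(q)=\arccos(\langle q,p\rangle)\,\frac{P_p(q-p)}{\|P_p(q-p)\|}$ for $q\ne\pm p$, and $\log_p(p)=0$. *)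

theory Defs
  imports "HOL-Analysis.Analysis" "HOL-Computational_Algebra.Polynomial"
begin

(* det of the polynomial matrix X I - A. *)
definition char_poly :: "real ^ 'n ^ 'n \<Rightarrow> real poly" where
  "char_poly A = det (\<chi> i j. (if i = j then [:0, 1:] else 0) - [:A $ i $ j:])"

(* lam 1 >= ... >= lam n are the n real eigenvalues of A, repeated according to algebraic
   multiplicity.  Values of lam outside {1..n} are irrelevant. *)
definition ordered_eigenvalues :: "real ^ 'n ^ 'n \<Rightarrow> (nat \<Rightarrow> real) \<Rightarrow> bool" where
  "ordered_eigenvalues A lam \<longleftrightarrow>
     char_poly A = (\<Prod>i\<in>{1..CARD('n)}. [:- lam i, 1:]) \<and>
     (\<forall>i\<in>{1..CARD('n)}. \<forall>j\<in>{1..CARD('n)}. i \<le> j \<longrightarrow> lam j \<le> lam i)"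

(* Given by the same formula on all of R^n; the Euclidean gradient is that of this extension. *)
definition cost :: "real ^ 'n ^ 'n \<Rightarrow> real ^ 'n \<Rightarrow> real" where
  "cost A x = - (x \<bullet> (A *v x))"

definition euclidean_gradient :: "(real ^ 'n \<Rightarrow> real) \<Rightarrow> real ^ 'n \<Rightarrow> real ^ 'n" where
  "euclidean_gradient f x = (THE D. GDERIV f x :> D)"

definition tangent_projector :: "real ^ 'n \<Rightarrow> real ^ 'n ^ 'n" where
  "tangent_projector x = mat 1 - (columnvector x :: real ^ 1 ^ 'n) ** rowvector x"

definition riemannian_gradient :: "(real ^ 'n \<Rightarrow> real) \<Rightarrow> real ^ 'n \<Rightarrow> real ^ 'n" where
  "riemannian_gradient f x = tangent_projector x *v euclidean_gradient f x"

(* Meaningful for unit vectors p, q with q \<noteq> - p; at q = - p the division by zero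
   gives the junk value 0. *)
definition sphere_log :: "real ^ 'n \<Rightarrow> real ^ 'n \<Rightarrow> real ^ 'n" where
  "sphere_log p q =
     (if q = p then 0
      else (arccos (q \<bullet> p) / norm (tangent_projector p *v (q - p)))
             *\<^sub>R (tangent_projector p *v (q - p)))"

definition sphere_cap :: "real ^ 'n \<Rightarrow> real \<Rightarrow> (real ^ 'n) set" where
  "sphere_cap v a = {x \<in> sphere 0 1. a \<le> x \<bullet> v}"

end

theory Submission
  imports Defs
begin

(* A maximiser of the Rayleigh quotient is an eigenvector, so its value is a root of the
   characteristic polynomial and the quotient is bounded by lam 1.  For unit x with c = <x, v1>,
   the projection of v1 - x is v1 - c x, of norm sqrt (1 - c^2), and symmetry of A gives
   <grad f(x), -(v1 - c x)> = 2 c (f(x) - f(v1)).  Thus the right-hand side is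
   2 c (f(x) - f(v1)) times arccos c / sin (arccos c), and this ratio is at least 1. *)

text \<open>Evaluation at \<open>mu\<close> is a ring homomorphism, so it passes through the Leibniz
  expansion of the determinant.\<close>

lemma poly_char_poly: "poly (char_poly A) mu = det (mat mu - A)"
proof -
  have "poly (if i = j then [:0, 1:] else 0) mu - A $ i $ j = (mat mu - A) $ i $ j" for i j
    by (simp add: mat_def)
  then show ?thesis
    by (simp add: char_poly_def det_def poly_sum poly_prod)
qed

lemma eigenvalue_is_root_char_poly:
  fixes A :: "real ^ 'n ^ 'n"
  assumes "A *v u = mu *\<^sub>R u" "u \<noteq> 0"
  shows "poly (char_poly A) mu = 0"
proof -
  have "(mat mu :: real ^ 'n ^ 'n) *v u = mu *\<^sub>R u"
    by (simp add: vec_eq_iff matrix_vector_mult_def mat_def mult_delta_left)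
  then have "(mat mu - A) *v u = 0"
    using assms(1) by (simp add: matrix_vector_mult_diff_rdistrib)
  then have "\<not> invertible (mat mu - A)"
    using assms(2) by (metis invertible_def matrix_left_invertible_ker)
  then show ?thesis
    by (simp add: poly_char_poly invertible_det_nz)
qed

lemma eigenvalue_le_first:
  assumes "ordered_eigenvalues (A :: real ^ 'n ^ 'n) lam" "poly (char_poly A) mu = 0"
  shows "mu \<le> lam 1"
proof -
  obtain i where "i \<in> {1..CARD('n)}" "mu = lam i"
    using assms by (auto simp: ordered_eigenvalues_def poly_prod)
  then show ?thesis
    using assms(1) unfolding ordered_eigenvalues_def
    by (metis atLeastAtMost_iff order_refl order_trans)
qed

lemma inner_symmetric_matrix:
  fixes A :: "real ^ 'n ^ 'n"
  assumes "transpose A = A"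
  shows "(A *v x) \<bullet> y = x \<bullet> (A *v y)"
  using assms by (metis dot_lmul_matrix transpose_matrix_vector)

text \<open>First-order optimality without calculus: for small t of sign opposite to b the linear
  term would dominate and make the expression negative.\<close>

lemma nonneg_quadratic_linear_coeff_zero:
  fixes b c :: real
  assumes "\<And>t. 0 \<le> 2 * t * b + t\<^sup>2 * c"
  shows "b = 0"
proof (rule ccontr)
  assume "b \<noteq> 0"
  \<comment> \<open>With t = - b / k the expression is (b / k)^2 (c - 2 k), negative once k > 0 and
    c < k.\<close>
  define k where "k = \<bar>c\<bar> + 1"
  have k: "k > 0" "c < k" by (auto simp: k_def)
  have "0 \<le> 2 * (- b / k) * b + (- b / k)\<^sup>2 * c" by (rule assms)
  also have "\<dots> = (b / k)\<^sup>2 * (c - 2 * k)"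
    using k by (simp add: field_simps power2_eq_square)
  also have "\<dots> < 0"
    using k \<open>b \<noteq> 0\<close> by (intro mult_pos_neg) auto
  finally show False by simp
qed

text \<open>The form mu <y,y> - <y,Ay> is nonnegative and vanishes at u. Moving from u along the
  residual w = mu u - A u gives a quadratic in t with linear coefficient 2 <w,w>, which must be
  zero.\<close>

lemma symmetric_rayleigh_max_eigenvector:
  fixes A :: "real ^ 'n ^ 'n"
  assumes sym: "transpose A = A" and u: "norm u = 1"
    and max: "\<And>y. norm y = 1 \<Longrightarrow> y \<bullet> (A *v y) \<le> u \<bullet> (A *v u)"
  shows "A *v u = (u \<bullet> (A *v u)) *\<^sub>R u"
proof -
  define mu where "mu = u \<bullet> (A *v u)"
  \<comment> \<open>Homogeneity extends the bound from the sphere to all vectors, so u + t w need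
    not be normalised.\<close>
  have le: "y \<bullet> (A *v y) \<le> mu * (y \<bullet> y)" for y
  proof (cases "y = 0")
    case False
    have "(y /\<^sub>R norm y) \<bullet> (A *v (y /\<^sub>R norm y)) \<le> mu"
      using max[of "y /\<^sub>R norm y"] False by (simp add: mu_def)
    then have "y \<bullet> (A *v y) / (norm y * norm y) \<le> mu"
      by (simp add: matrix_vector_mult_scaleR divide_inverse mult_ac)
    then show ?thesis
      using False by (simp add: divide_le_eq dot_square_norm power2_eq_square)
  qed simp
  define w where "w = mu *\<^sub>R u - A *v u"
  have uu: "u \<bullet> u = 1" using u by (simp add: dot_square_norm)
  have "0 \<le> 2 * t * (w \<bullet> w) + t\<^sup>2 * (mu * (w \<bullet> w) - w \<bullet> (A *v w))" for t
  proof -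
    have "0 \<le> mu * ((u + t *\<^sub>R w) \<bullet> (u + t *\<^sub>R w)) - (u + t *\<^sub>R w) \<bullet> (A *v (u + t *\<^sub>R w))"
      using le[of "u + t *\<^sub>R w"] by simp
    also have "\<dots> = mu + 2 * t * mu * (u \<bullet> w) + t\<^sup>2 * mu * (w \<bullet> w)
        - (mu + 2 * t * (w \<bullet> (A *v u)) + t\<^sup>2 * (w \<bullet> (A *v w)))"
      using inner_symmetric_matrix[OF sym, of u w]
      by (simp add: matrix_vector_mult_scaleR matrix_vector_right_distrib inner_simps uu
          mu_def[symmetric] inner_commute[of w u] inner_commute[of "A *v u" w]
          power2_eq_square algebra_simps)
    also have "\<dots> = 2 * t * (mu * (u \<bullet> w) - w \<bullet> (A *v u))
        + t\<^sup>2 * (mu * (w \<bullet> w) - w \<bullet> (A *v w))"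
      by (simp add: algebra_simps)
    also have "mu * (u \<bullet> w) - w \<bullet> (A *v u) = w \<bullet> w"
      \<comment> \<open>Only the right factor of \<open>w \<bullet> w\<close> is unfolded.\<close>
      by (subst (4) w_def) (simp add: inner_simps inner_commute)
    finally show ?thesis .
  qed
  then have "w \<bullet> w = 0" by (rule nonneg_quadratic_linear_coeff_zero)
  then show ?thesis by (simp add: w_def mu_def)
qed

text \<open>One maximiser, which exists since the sphere is compact, is enough here; no
  diagonalisation of A is required.\<close>

lemma rayleigh_le_first_eigenvalue:
  fixes A :: "real ^ 'n ^ 'n"
  assumes sym: "transpose A = A" and ev: "ordered_eigenvalues A lam" and x: "norm x = 1"
  shows "x \<bullet> (A *v x) \<le> lam 1"
proof -
  have "continuous_on (sphere 0 1) (\<lambda>y. y \<bullet> (A *v y))"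
    by (intro continuous_intros linear_continuous_on_compose[where g = "(*v) A"]) auto
  moreover have "sphere 0 1 \<noteq> ({} :: (real ^ 'n) set)" using x by auto
  ultimately obtain u where u: "norm u = 1"
    and max: "\<And>y. norm y = 1 \<Longrightarrow> y \<bullet> (A *v y) \<le> u \<bullet> (A *v u)"
    using continuous_attains_sup[OF compact_sphere[of 0 1]] by force
  have "A *v u = (u \<bullet> (A *v u)) *\<^sub>R u"
    by (rule symmetric_rayleigh_max_eigenvector[OF sym u max])
  moreover have "u \<noteq> 0" using u by auto
  ultimately have "u \<bullet> (A *v u) \<le> lam 1"
    using eigenvalue_le_first[OF ev] eigenvalue_is_root_char_poly by blast
  then show ?thesis using max[OF x] by linarith
qed

lemma euclidean_gradient_cost:
  fixes A :: "real ^ 'n ^ 'n"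
  assumes sym: "transpose A = A"
  shows "euclidean_gradient (cost A) x = - 2 *\<^sub>R (A *v x)"
proof -
  have A: "((*v) A has_derivative (*v) A) (at x)"
    by (rule linear_imp_has_derivative) simp
  have "(cost A has_derivative (\<lambda>h. - (x \<bullet> (A *v h) + h \<bullet> (A *v x)))) (at x)"
    unfolding cost_def
    by (rule has_derivative_minus[OF has_derivative_inner[OF has_derivative_ident A]])
  moreover have "- (x \<bullet> (A *v h) + h \<bullet> (A *v x)) = h \<bullet> (- 2 *\<^sub>R (A *v x))" for h
    using inner_symmetric_matrix[OF sym, of x h] inner_commute[of "A *v x" h] by simp
  ultimately have *: "GDERIV (cost A) x :> - 2 *\<^sub>R (A *v x)"
    by (simp add: gderiv_def)
  \<comment> \<open>Uniqueness, so that the \<open>THE\<close> in \<open>euclidean_gradient\<close>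
    denotes this vector: equal derivatives have equal inner products with every h.\<close>
  moreover have "D = - 2 *\<^sub>R (A *v x)" if "GDERIV (cost A) x :> D" for D
    using has_derivative_unique[OF that[unfolded gderiv_def] *[unfolded gderiv_def]]
    by (metis vector_eq_ldot)
  ultimately show ?thesis
    unfolding euclidean_gradient_def by blast
qed

lemma tangent_projector_mult:
  fixes x :: "real ^ 'n"
  shows "tangent_projector x *v y = y - (x \<bullet> y) *\<^sub>R x"
proof -
  have "((columnvector x :: real ^ 1 ^ 'n) ** rowvector x) *v y = (x \<bullet> y) *\<^sub>R x"
    by (simp add: vec_eq_iff matrix_vector_mult_def matrix_matrix_mult_def columnvector_def
        rowvector_def inner_vec_def sum_distrib_left mult_ac)
  then show ?thesis
    by (simp add: tangent_projector_def matrix_vector_mult_diff_rdistrib)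
qed

text \<open>With theta = arccos c in [0, pi] this is sin theta \<le> theta.\<close>

lemma sin_arccos_le_arccos:
  assumes "-1 \<le> c" "c \<le> 1"
  shows "sqrt (1 - c\<^sup>2) \<le> arccos c"
  using sin_x_le_x[OF arccos_lbound[OF assms]] sin_arccos[OF assms] by simp

text \<open>The antipode x = - v is covered as well: both sides are 0 there by the convention for
  division by zero.\<close>

lemma grad_inner_log:
  fixes A :: "real ^ 'n ^ 'n"
  assumes sym: "transpose A = A" and x: "norm x = 1" and v: "norm v = 1"
    and Av: "A *v v = l *\<^sub>R v" and "x \<noteq> v"
  shows "riemannian_gradient (cost A) x \<bullet> (- sphere_log x v) =
    (arccos (x \<bullet> v) / sqrt (1 - (x \<bullet> v)\<^sup>2)) * (2 * (x \<bullet> v) * (cost A x + l))"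
proof -
  define c where "c = x \<bullet> v"
  have xx: "x \<bullet> x = 1" and vv: "v \<bullet> v = 1"
    using x v by (simp_all add: dot_square_norm)
  have P: "tangent_projector x *v (v - x) = v - c *\<^sub>R x"
    by (simp add: tangent_projector_mult inner_diff_right xx c_def algebra_simps)
  have "(v - c *\<^sub>R x) \<bullet> (v - c *\<^sub>R x) = 1 - c\<^sup>2"
    using inner_commute[of v x]
    by (simp add: inner_simps xx vv c_def[symmetric] power2_eq_square)
  then have N: "norm (v - c *\<^sub>R x) = sqrt (1 - c\<^sup>2)"
    by (simp add: norm_eq_sqrt_inner)
  have Avx: "(A *v x) \<bullet> v = l * c"
    using inner_symmetric_matrix[OF sym, of x v] by (simp add: Av c_def)
  have G: "riemannian_gradient (cost A) x = - 2 *\<^sub>R (A *v x) - (2 * cost A x) *\<^sub>R x"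
    by (simp add: riemannian_gradient_def euclidean_gradient_cost[OF sym]
        tangent_projector_mult cost_def)
  \<comment> \<open>Since v - c x is orthogonal to x, only - 2 A x contributes, through <Ax,v> = l c
    and <Ax,x> = - \<open>cost A x\<close>.\<close>
  have "riemannian_gradient (cost A) x \<bullet> (v - c *\<^sub>R x) = - (2 * c * (cost A x + l))"
    using Avx inner_commute[of "A *v x" x]
    by (simp add: G inner_simps xx c_def[symmetric] cost_def algebra_simps)
  then show ?thesis
    using \<open>x \<noteq> v\<close>
    by (simp add: sphere_log_def P N inner_commute[of v x] c_def[symmetric])
qed

theorem proposition1:
  fixes M :: "real ^ 'd ^ 'm" and A :: "real ^ 'd ^ 'd"
    and lam :: "nat \<Rightarrow> real" and v1 :: "real ^ 'd"
  assumes "CARD('d) \<ge> 2"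
    and "A = transpose M ** M"
    and "ordered_eigenvalues A lam"
    and "lam 1 - lam 2 > 0"
    and "norm v1 = 1" and "A *v v1 = lam 1 *\<^sub>R v1"
  shows "is_arg_min (cost A) (\<lambda>y. y \<in> sphere 0 1) v1 \<and> cost A v1 = - lam 1 \<and>
    (\<forall>a>0. \<forall>x\<in>sphere_cap v1 a.
       2 * a * (cost A x - cost A v1)
         \<le> riemannian_gradient (cost A) x \<bullet> (- sphere_log x v1))"
proof (intro conjI allI impI ballI)
  have sym: "transpose A = A"
    using assms(2) by (simp add: matrix_transpose_mul)
  show cost_v1: "cost A v1 = - lam 1"
    using assms(5,6) by (simp add: cost_def dot_square_norm)
  have min: "- lam 1 \<le> cost A x" if "norm x = 1" for x
    using rayleigh_le_first_eigenvalue[OF sym assms(3) that] by (simp add: cost_def)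
  show "is_arg_min (cost A) (\<lambda>y. y \<in> sphere 0 1) v1"
    using min assms(5) by (force simp: is_arg_min_linorder cost_v1)
  fix a :: real and x
  assume "a > 0" and cap: "x \<in> sphere_cap v1 a"
  define c where "c = x \<bullet> v1"
  have x: "norm x = 1" and ac: "a \<le> c"
    using cap by (simp_all add: sphere_cap_def c_def)
  show "2 * a * (cost A x - cost A v1)
      \<le> riemannian_gradient (cost A) x \<bullet> (- sphere_log x v1)"
  proof (cases "x = v1")
    \<comment> \<open>Both sides are 0. This point is treated apart because the ratio below would
      have denominator 0.\<close>
    case True
    then show ?thesis by (simp add: sphere_log_def)
  next
    case False
    have "c \<le> 1"
      using norm_cauchy_schwarz[of x v1] x assms(5) by (simp add: c_def)
    \<comment> \<open>Equality in Cauchy-Schwarz for unit vectors forces x = v1.\<close>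
    moreover have "c \<noteq> 1"
      using False norm_cauchy_schwarz_eq[of x v1] x assms(5) by (simp add: c_def)
    \<comment> \<open>Positivity of c also keeps x away from - v1, where \<open>sphere_log\<close>
      has a junk value.\<close>
    ultimately have c: "0 < c" "c < 1" using \<open>a > 0\<close> ac by auto
    then have "0 < sqrt (1 - c\<^sup>2)" by (simp add: power_less_one_iff abs_square_less_1)
    then have ratio: "1 \<le> arccos c / sqrt (1 - c\<^sup>2)"
      using sin_arccos_le_arccos[of c] c by simp
    have gap: "0 \<le> cost A x + lam 1" using min[OF x] by simp
    \<comment> \<open>Nonnegativity of the optimality gap allows a to be raised to c, and then the
      factor \<open>ratio\<close> to be inserted.\<close>
    have "2 * a * (cost A x - cost A v1) \<le> 2 * c * (cost A x + lam 1)"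
      using ac gap by (simp add: cost_v1 mult_right_mono)
    also have "\<dots> \<le> (arccos c / sqrt (1 - c\<^sup>2)) * (2 * c * (cost A x + lam 1))"
      using mult_right_mono[OF ratio, of "2 * c * (cost A x + lam 1)"] c gap by simp
    also have "\<dots> = riemannian_gradient (cost A) x \<bullet> (- sphere_log x v1)"
      using grad_inner_log[OF sym x assms(5,6) False] by (simp add: c_def)
    finally show ?thesis .
  qed
qed

end
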